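(* Let $G\not\equiv0$ be an infinitesimal generator in $\mathbb{D}$, let $h:\mathbb{D}\to\mathbb{C}$ be the associated normalized K\"onigs function, and let $x\in\partial\mathbb{D}$. The following are equivalent: (1) $x$ is a regular pole of $G$; (2) $x$ is a $\beta$-point of $h$; (3) $\liminf_{(0,1)\ni r\to1}\frac{|h'(rx)|}{1-r}<+\infty$; (4) $\angle\lim_{z\to x}h(z)$ exists in $\mathbb{C}$, $\angle\lim_{z\to x}h'(z)=0$, and $\angle\lim_{z\to x}h''(z)=\ell$ exists in $\mathbb{C}$; (5) $\lim_{(0,1)\ni r\to1}|h'(rx)|=0$ and $\limsup_{(0,1)\ni r\to1}|h''(rx)|<+\infty$. Moreover, let $\tau\in\overline{\mathbb{D}}$ be the Denjoy-Wolff point of $G$. If these conditions are satisfied and $A=\angle\lim_{z\to x}G(z)(z-x)$ (so that $x$ is a regular pole of $G$ of mass $|A|$), then: (a) if $\tau\in\mathbb{D}$, then $$\angle\lim_{z\to x}h''(z)=\angle\lim_{z\to x}\frac{h'(z)}{z-x}=\frac{h(x)G'(\tau)}{A}\neq0,$$ where $h(x)=\angle\lim_{z\to x}h(z)$; (b) if $\tau\in\partial\mathbb{D}$, then $$\angle\lim_{z\to x}h''(z)=\angle\lim_{z\to x}\frac{h'(z)}{z-x}=\frac1A.$$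
   Context: $\mathbb{D}$ is the open unit disc in $\mathbb{C}$. A semigroup $(\phi_t)_{t\ge0}$ of holomorphic self-maps of $\mathbb{D}$ is a family of holomorphic maps $\phi_t:\mathbb{D}\to\mathbb{D}$ with $\phi_0=\mathrm{id}$, $\phi_{t+s}=\phi_t\circ\phi_s$, and $t\mapsto\phi_t$ continuous for uniform convergence on compacta. Its infinitesimal generator is the unique holomorphic $G:\mathbb{D}\to\mathbb{C}$ with $\partial_t\phi_t(z)=G(\phi_t(z))$ for all $t\ge 0$, $z\in\mathbb D$; an infinitesimal generator in $\mathbb D$ is a $G$ arising this way. Berkson-Porta formula: if $G\not\equiv0$ there are a unique $\tau\in\overline{\mathbb{D}}$ (the Denjoy-Wolff point of $G$) and a unique holomorphic $p:\mathbb{D}\to\mathbb{C}$ with $\mathrm{Re}\,p\ge0$ such that $G(z)=(z-\tau)(\overline{\tau}z-1)p(z)$. K\"onigs function $h$ associated with $G\not\equiv 0$: the unique univalent $h:\mathbb{D}\to\mathbb{C}$ such that: if $\tau\in\mathbb{D}$, then $h(\tau)=0$, $h'(\tau)=1$ and $h'(z)G(z)=G'(\tau)h(z)$ for all $z\in\mathbb D$ (so $h\circ\phi_t=e^{G'(\tau)t}h$); if $\tau\in\partial\mathbb{D}$, then $h(0)=0$ and $h'(z)G(z)=1$ for all $z\in\mathbb D$ (so $h\circ\phi_t=h+t$). $\angle\lim$, $\angle\liminf$, $\angle\limsup$ as $z\to x\in\partial\mathbb D$ denote non-tangential limit, lower limit and upper limit, i.e. taken as $z\to x$ inside Stolz angles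 $\{z\in\mathbb{D}:|x-z|<R(1-|z|)\}$, $R>1$. A point $x\in\partial\mathbb{D}$ is a regular pole of $G$ of mass $C>0$ if $\angle\liminf_{z\to x}|G(z)(x-z)|=C$ with $C\in(0,+\infty)$; it is a regular pole if this holds for some such $C$. (For an infinitesimal generator the limit $\angle\lim_{z\to x}G(z)(x-z)$ always exists in $\mathbb{C}$.) For a holomorphic $f:\mathbb{D}\to\mathbb{C}$, a point $x\in\partial\mathbb{D}$ is a $\beta$-point of $f$ if $\angle\limsup_{z\to x}\frac{|f'(z)|}{|x-z|}=L<+\infty$. *)

theory Defs
  imports "HOL-Complex_Analysis.Complex_Analysis"
begin

abbreviation unit_disc :: "complex set" (\<open>\<D>\<close>) where
  "\<D> \<equiv> ball 0 1"

text \<open>Families over \<open>[0,\<infinity>)\<close> and maps on the disc are total functions in HOL;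
  their values at negative times or outside the disc are irrelevant throughout.\<close>

definition holomorphic_semigroup :: "(real \<Rightarrow> complex \<Rightarrow> complex) \<Rightarrow> bool" where
  "holomorphic_semigroup \<phi> \<longleftrightarrow>
     (\<forall>t\<ge>0. \<phi> t holomorphic_on \<D> \<and> \<phi> t ` \<D> \<subseteq> \<D>) \<and>
     (\<forall>z\<in>\<D>. \<phi> 0 z = z) \<and>
     (\<forall>t\<ge>0. \<forall>s\<ge>0. \<forall>z\<in>\<D>. \<phi> (t + s) z = \<phi> t (\<phi> s z)) \<and>
     (\<forall>K. compact K \<and> K \<subseteq> \<D> \<longrightarrow>
        (\<forall>t\<ge>0. uniform_limit K \<phi> (\<phi> t) (at t within {0..})))"

definition generator_of :: "(complex \<Rightarrow> complex) \<Rightarrow> (real \<Rightarrow> complex \<Rightarrow> complex) \<Rightarrow> bool" where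
  "generator_of G \<phi> \<longleftrightarrow> G holomorphic_on \<D> \<and>
     (\<forall>t\<ge>0. \<forall>z\<in>\<D>. ((\<lambda>s. \<phi> s z) has_vector_derivative G (\<phi> t z)) (at t within {0..}))"

definition infinitesimal_generator :: "(complex \<Rightarrow> complex) \<Rightarrow> bool" where
  "infinitesimal_generator G \<longleftrightarrow> (\<exists>\<phi>. holomorphic_semigroup \<phi> \<and> generator_of G \<phi>)"

text \<open>The point \<open>\<tau>\<close> of the Berkson-Porta formula; for a generator \<open>G \<noteq> 0\<close> there is exactly one.\<close>

definition denjoy_wolff_point :: "(complex \<Rightarrow> complex) \<Rightarrow> complex \<Rightarrow> bool" where
  "denjoy_wolff_point G \<tau> \<longleftrightarrow> \<tau> \<in> cball 0 1 \<and>
     (\<exists>p. p holomorphic_on \<D> \<and> (\<forall>z\<in>\<D>. Re (p z) \<ge> 0) \<and>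
          (\<forall>z\<in>\<D>. G z = (z - \<tau>) * (cnj \<tau> * z - 1) * p z))"

text \<open>\<open>h\<close> is the normalized Koenigs function of \<open>G\<close>, where \<open>\<tau>\<close> is the Denjoy-Wolff point of \<open>G\<close>.\<close>

definition koenigs_function ::
    "(complex \<Rightarrow> complex) \<Rightarrow> complex \<Rightarrow> (complex \<Rightarrow> complex) \<Rightarrow> bool" where
  "koenigs_function G \<tau> h \<longleftrightarrow> h holomorphic_on \<D> \<and> inj_on h \<D> \<and>
     (\<tau> \<in> \<D> \<longrightarrow> h \<tau> = 0 \<and> deriv h \<tau> = 1 \<and> (\<forall>z\<in>\<D>. deriv h z * G z = deriv G \<tau> * h z)) \<and>
     (\<tau> \<in> sphere 0 1 \<longrightarrow> h 0 = 0 \<and> (\<forall>z\<in>\<D>. deriv h z * G z = 1))"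

definition stolz_angle :: "complex \<Rightarrow> real \<Rightarrow> complex set" where
  "stolz_angle x R = {z \<in> \<D>. cmod (x - z) < R * (1 - cmod z)}"

definition nt_limit :: "(complex \<Rightarrow> complex) \<Rightarrow> complex \<Rightarrow> complex \<Rightarrow> bool" where
  "nt_limit f x l \<longleftrightarrow> (\<forall>R>1. (f \<longlongrightarrow> l) (at x within stolz_angle x R))"

text \<open>Non-tangential lower and upper limits: the extreme values over all Stolz angles
  at \<open>x\<close> of the lower and upper limits taken inside the angle.\<close>

definition nt_Liminf :: "(complex \<Rightarrow> ereal) \<Rightarrow> complex \<Rightarrow> ereal" where
  "nt_Liminf f x = (INF R\<in>{1<..}. Liminf (at x within stolz_angle x R) f)"

definition nt_Limsup :: "(complex \<Rightarrow> ereal) \<Rightarrow> complex \<Rightarrow> ereal" where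
  "nt_Limsup f x = (SUP R\<in>{1<..}. Limsup (at x within stolz_angle x R) f)"

definition regular_pole_of_mass :: "(complex \<Rightarrow> complex) \<Rightarrow> complex \<Rightarrow> real \<Rightarrow> bool" where
  "regular_pole_of_mass G x C \<longleftrightarrow>
     C > 0 \<and> nt_Liminf (\<lambda>z. ereal (cmod (G z * (x - z)))) x = ereal C"

definition regular_pole :: "(complex \<Rightarrow> complex) \<Rightarrow> complex \<Rightarrow> bool" where
  "regular_pole G x \<longleftrightarrow> (\<exists>C. regular_pole_of_mass G x C)"

definition beta_point :: "(complex \<Rightarrow> complex) \<Rightarrow> complex \<Rightarrow> bool" where
  "beta_point f x \<longleftrightarrow> nt_Limsup (\<lambda>z. ereal (cmod (deriv f z) / cmod (x - z))) x < \<infinity>"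

end

theory Submission imports Defs begin

text \<open>Writing \<open>G\<close> in Berkson-Porta form, the Julia-Wolff lemma for the half-plane valued factor
  shows that \<open>G z * (z - x)\<close> always has a nontangential limit \<open>A\<close>, and \<open>x\<close> is a regular pole iff
  \<open>A \<noteq> 0\<close>. The Koenigs function satisfies \<open>h' * G = N\<close> where \<open>N\<close> is constant or a nonzero multiple of
  \<open>h\<close>; by injectivity \<open>N\<close> stays away from \<open>0\<close> near \<open>x\<close>, so \<open>A = 0\<close> would force
  \<open>h' / (z - x)\<close> to blow up along the radius. If \<open>A \<noteq> 0\<close>, the logarithmic derivative of \<open>h\<close> is
  bounded on the (convex) Stolz angles near \<open>x\<close>, which gives the limit of \<open>h\<close>, then that of
  \<open>h' / (z - x) = N / (G * (z - x))\<close>, and Cauchy's estimate on discs that are comparable to the distance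
  from \<open>x\<close> transfers it to \<open>h''\<close>.\<close>

subsection \<open>The Schwarz-Pick lemma for half-plane valued functions\<close>

text \<open>Reduces to the Schwarz lemma: the disc automorphism \<open>n\<close> takes
  \<open>0\<close> to \<open>w\<close>, and the half plane is mapped to the disc by the Cayley-type
  map sending \<open>q w\<close> to \<open>0\<close>. The inequality is kept multiplied out so that
  it can be squared directly.\<close>

lemma Schwarz_Pick_half_plane:
  assumes q: "q holomorphic_on \<D>" "\<And>z. z \<in> \<D> \<Longrightarrow> Re (q z) > 0"
    and z: "z \<in> \<D>" and w: "w \<in> \<D>"
  shows "cmod (q z - q w) * cmod (1 - cnj w * z) \<le> cmod (z - w) * cmod (q z + cnj (q w))"
proof -
  define m where "m = Moebius_function 0 w"
  define n where "n = Moebius_function 0 (-w)"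
  define f where "f = (\<lambda>u. (q (n u) - q w) / (q (n u) + cnj (q w)))"
  have w1: "norm w < 1" "norm z < 1" using z w by auto
  have nD: "n ` \<D> \<subseteq> \<D>" and n: "n holomorphic_on \<D>" and m1: "norm (m z) < 1"
    using Moebius_function_norm_lt_1[of "-w"] Moebius_function_holomorphic[of "-w"]
      Moebius_function_norm_lt_1[of w z] w1 unfolding n_def m_def by auto
  have nz: "q u + cnj (q w) \<noteq> 0" if "u \<in> \<D>" for u
    using q(2)[OF that] q(2)[OF w] by (auto simp: complex_eq_iff)
  have qn: "(\<lambda>u. q (n u)) holomorphic_on \<D>"
    using holomorphic_on_compose_gen[OF n q(1)] nD by (auto simp: o_def)
  have "norm (f (m z)) \<le> norm (m z)"
  proof (rule Schwarz_Lemma(1))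
    show "f holomorphic_on ball 0 1"
      unfolding f_def by (intro holomorphic_intros qn) (use nD nz in blast)
    show "f 0 = 0" by (simp add: f_def n_def Moebius_function_of_zero)
    show "norm (f u) < 1" if u: "norm u < 1" for u
    proof -
      define a b where "a = q (n u)" and "b = q w"
      have "n u \<in> \<D>" using nD u by (simp add: image_subset_iff)
      then have "Re a > 0" "Re b > 0" using q(2) w by (auto simp: a_def b_def)
      \<comment> \<open>The two squares differ by \<open>4 * Re a * Re b\<close>.\<close>
      then have "(cmod (a - b))\<^sup>2 < (cmod (a + cnj b))\<^sup>2"
        unfolding cmod_power2 by (simp add: power2_eq_square algebra_simps)
      then have "cmod (a - b) < cmod (a + cnj b)" using power_less_imp_less_base by force
      then show ?thesis unfolding f_def a_def[symmetric] b_def[symmetric]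
        by (simp add: norm_divide)
          (metis \<open>cmod (a - b) < cmod (a + cnj b)\<close> divide_less_eq_1 norm_ge_zero order_le_less_trans)
    qed
  qed (use m1 in auto)
  moreover have "n (m z) = z" unfolding n_def m_def
    by (rule Moebius_function_compose) (use w1 in auto)
  ultimately have "cmod ((q z - q w) / (q z + cnj (q w))) \<le> cmod ((z - w) / (1 - cnj w * z))"
    by (simp add: f_def m_def Moebius_function_simple)
  moreover have "1 - cnj w * z \<noteq> 0"
  proof
    assume "1 - cnj w * z = 0"
    then have "cmod (cnj w * z) = 1" by simp
    moreover have "cmod (cnj w * z) < 1 * 1"
      unfolding norm_mult complex_mod_cnj using w1 by (intro mult_strict_mono) auto
    ultimately show False by simp
  qed
  ultimately show ?thesis using nz[OF z]
    by (simp add: norm_divide field_simps)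
qed

text \<open>After squaring Schwarz-Pick, the terms \<open>P\<^sup>2 * M\<^sup>2\<close> cancel; then
  \<open>Re (q z) \<le> P\<close> allows one factor \<open>P\<close> to be divided out. The growth
  of \<open>q\<close> at the boundary is thus controlled by \<open>Re (q w)\<close> at a single base
  point \<open>w\<close>.\<close>

lemma half_plane_growth:
  assumes q: "q holomorphic_on \<D>" "\<And>z. z \<in> \<D> \<Longrightarrow> Re (q z) > 0"
    and z: "z \<in> \<D>" and w: "w \<in> \<D>"
  shows "cmod (q z + cnj (q w)) * ((1 - (cmod z)\<^sup>2) * (1 - (cmod w)\<^sup>2))
         \<le> 4 * Re (q w) * (cmod (1 - cnj w * z))\<^sup>2"
proof -
  define P M E where "P = cmod (q z + cnj (q w))" and "M = cmod (1 - cnj w * z)"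
    and "E = (1 - (cmod z)\<^sup>2) * (1 - (cmod w)\<^sup>2)"
  have a: "Re (q z) > 0" and b: "Re (q w) > 0" using q z w by auto
  have 1: "(cmod (q z - q w))\<^sup>2 = P\<^sup>2 - 4 * Re (q z) * Re (q w)"
    unfolding P_def cmod_power2 by (simp add: power2_eq_square algebra_simps)
  have 2: "(cmod (z - w))\<^sup>2 = M\<^sup>2 - E"
    unfolding M_def E_def cmod_power2 by (simp add: power2_eq_square algebra_simps)
  have "(cmod (q z - q w) * M)\<^sup>2 \<le> (cmod (z - w) * P)\<^sup>2"
    using Schwarz_Pick_half_plane[OF assms] unfolding P_def M_def
    by (intro power_mono) auto
  then have "P\<^sup>2 * E \<le> 4 * Re (q z) * Re (q w) * M\<^sup>2"
    unfolding power_mult_distrib 1 2 by (simp add: algebra_simps)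
  also have "\<dots> \<le> 4 * P * Re (q w) * M\<^sup>2"
  proof -
    have "Re (q z) \<le> P" using complex_Re_le_cmod[of "q z + cnj (q w)"] b unfolding P_def by simp
    then show ?thesis using b by (intro mult_right_mono) auto
  qed
  finally have "P * (P * E) \<le> P * (4 * Re (q w) * M\<^sup>2)" by (simp add: power2_eq_square algebra_simps)
  moreover have "P > 0" using a b complex_Re_le_cmod[of "q z + cnj (q w)"] unfolding P_def
    by (simp del: zero_less_norm_iff)
  ultimately show ?thesis unfolding P_def[symmetric] M_def[symmetric] E_def[symmetric] by simp
qed

subsection \<open>Stolz angles and nontangential limits\<close>

lemma open_stolz_angle: "open (stolz_angle x R)"
  unfolding stolz_angle_def
  by (auto simp: Collect_conj_eq mem_ball intro!: open_Int open_Collect_less continuous_intros)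

text \<open>The angle is the part of the disc where the convex function
  \<open>cmod (x - z) + R * cmod z\<close> is below \<open>R\<close>. Convexity is what later
  permits mean value estimates and holomorphic logarithms.\<close>

lemma convex_stolz_angle:
  assumes "R > 0" shows "convex (stolz_angle x R)"
proof -
  have "stolz_angle x R = \<D> \<inter> {z. cmod (x - z) + R * cmod z < R}"
    by (auto simp: stolz_angle_def algebra_simps)
  moreover have "convex {z. cmod (x - z) + R * cmod z < R}"
  proof (rule convexI)
    fix z w u v assume zw: "z \<in> {z. cmod (x - z) + R * cmod z < R}" "w \<in> {z. cmod (x - z) + R * cmod z < R}"
      and uv: "0 \<le> (u::real)" "0 \<le> v" "u + v = 1"
    have "x - (u *\<^sub>R z + v *\<^sub>R w) = u *\<^sub>R (x - z) + v *\<^sub>R (x - w)"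
      using uv by (simp add: algebra_simps scaleR_left_distrib[symmetric])
    then have "cmod (x - (u *\<^sub>R z + v *\<^sub>R w)) \<le> u * cmod (x - z) + v * cmod (x - w)"
      using uv by (metis norm_triangle_le norm_scaleR abs_of_nonneg order_refl)
    moreover have "cmod (u *\<^sub>R z + v *\<^sub>R w) \<le> u * cmod z + v * cmod w"
      using uv by (metis norm_triangle_le norm_scaleR abs_of_nonneg order_refl)
    then have "R * cmod (u *\<^sub>R z + v *\<^sub>R w) \<le> R * (u * cmod z + v * cmod w)"
      using assms by (intro mult_left_mono) auto
    moreover have "u * (cmod (x - z) + R * cmod z) + v * (cmod (x - w) + R * cmod w) < R"
      using zw uv by (intro convex_bound_lt) auto
    ultimately show "u *\<^sub>R z + v *\<^sub>R w \<in> {z. cmod (x - z) + R * cmod z < R}"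
      by (simp add: algebra_simps)
  qed
  ultimately show ?thesis by (simp add: convex_Int)
qed

lemma stolz_angle_mono: "R \<le> S \<Longrightarrow> stolz_angle x R \<subseteq> stolz_angle x S"
proof
  fix z assume "R \<le> S" "z \<in> stolz_angle x R"
  moreover from this have "R * (1 - cmod z) \<le> S * (1 - cmod z)"
    by (intro mult_right_mono) (auto simp: stolz_angle_def)
  ultimately show "z \<in> stolz_angle x S" by (auto simp: stolz_angle_def intro: less_le_trans)
qed

lemma eventually_radius: "eventually (\<lambda>r. 0 < r \<and> r < 1) (at_left (1::real))"
  using eventually_at_left_real[of 0 1] by simp

lemma cmod_radius_diff:
  assumes "cmod x = 1" "r < 1" shows "cmod (of_real r * x - x) = 1 - r" "cmod (x - of_real r * x) = 1 - r"
proof -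
  have "of_real r * x - x = of_real (r - 1) * x" by (simp add: algebra_simps)
  then show "cmod (of_real r * x - x) = 1 - r" using assms by (simp only: norm_mult norm_of_real) auto
  then show "cmod (x - of_real r * x) = 1 - r" by (simp add: norm_minus_commute)
qed

lemma radius_in_stolz_angle:
  assumes "cmod x = 1" "R > 1" "0 < r" "r < 1"
  shows "of_real r * x \<in> stolz_angle x R"
  using assms cmod_radius_diff(2)[of x r] by (simp add: stolz_angle_def norm_mult)

text \<open>Transfers every statement along a Stolz angle to the radius, and also yields that the
  filter of the angle at \<open>x\<close> is nontrivial.\<close>

lemma filterlim_radius_stolz_angle:
  assumes "cmod x = 1" "R > 1"
  shows "filterlim (\<lambda>r. of_real r * x) (at x within stolz_angle x R) (at_left (1::real))"
  unfolding filterlim_at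
proof
  show "\<forall>\<^sub>F r in at_left 1. of_real r * x \<in> stolz_angle x R \<and> of_real r * x \<noteq> x"
    using eventually_radius
  proof eventually_elim
    case (elim r)
    then show ?case using radius_in_stolz_angle[of x R r] assms by auto
  qed
  have "((\<lambda>r. of_real r * x) \<longlongrightarrow> of_real 1 * x) (at_left (1::real))"
    by (intro tendsto_intros)
  then show "((\<lambda>r. of_real r * x) \<longlongrightarrow> x) (at_left (1::real))" by simp
qed

lemma stolz_angle_nontrivial:
  assumes "cmod x = 1" "R > 1"
  shows "at x within stolz_angle x R \<noteq> bot"
proof
  assume "at x within stolz_angle x R = bot"
  then have "eventually (\<lambda>_. False) (at_left (1::real))"
    using eventually_compose_filterlim[OF _ filterlim_radius_stolz_angle[OF assms], of "\<lambda>_. False"]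
    by simp
  then show False by (simp add: trivial_limit_at_left_real)
qed

lemma eventually_stolz_angle: "eventually (\<lambda>z. z \<in> stolz_angle x R) (at x within stolz_angle x R)"
  by (auto simp: eventually_at_filter)

lemma nt_limitI:
  "(\<And>R. R > 1 \<Longrightarrow> (f \<longlongrightarrow> l) (at x within stolz_angle x R)) \<Longrightarrow> nt_limit f x l"
  by (simp add: nt_limit_def)

lemma nt_limitD:
  "nt_limit f x l \<Longrightarrow> R > 1 \<Longrightarrow> (f \<longlongrightarrow> l) (at x within stolz_angle x R)"
  by (simp add: nt_limit_def)

lemma nt_limit_continuous:
  assumes "isCont f x" shows "nt_limit f x (f x)"
  using assms by (auto intro!: nt_limitI simp: isCont_def intro: tendsto_within_subset)

lemma nt_limit_mult:
  "nt_limit f x l \<Longrightarrow> nt_limit g x m \<Longrightarrow> nt_limit (\<lambda>z. f z * g z) x (l * m)"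
  unfolding nt_limit_def by (auto intro: tendsto_mult)

lemma nt_limit_cong:
  assumes "\<And>z. z \<in> \<D> \<Longrightarrow> f z = g z" shows "nt_limit f x l \<longleftrightarrow> nt_limit g x l"
proof -
  have "eventually (\<lambda>z. f z = g z) (at x within stolz_angle x R)" for R
    by (rule eventually_mono[OF eventually_stolz_angle]) (use assms in \<open>auto simp: stolz_angle_def\<close>)
  then show ?thesis unfolding nt_limit_def using tendsto_cong by blast
qed

subsection \<open>The Julia-Wolff lemma\<close>

text \<open>This is the Poisson kernel at \<open>x\<close>, obtained by expanding the fraction with
  \<open>cnj (x - z)\<close>.\<close>

lemma Re_Cayley:
  assumes "cmod x = 1" "z \<noteq> x"
  shows "Re ((x + z) / (x - z)) = (1 - (cmod z)\<^sup>2) / (cmod (x - z))\<^sup>2"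
proof -
  have "(cmod (x - z))\<^sup>2 \<noteq> 0" using assms by simp
  have "Re ((x + z) / (x - z)) = Re ((x + z) * cnj (x - z)) / (cmod (x - z))\<^sup>2"
    by (simp add: complex_div_cnj[of "x + z"])
  also have "Re ((x + z) * cnj (x - z)) = (cmod x)\<^sup>2 - (cmod z)\<^sup>2"
    unfolding cmod_power2 by (simp add: power2_eq_square algebra_simps)
  finally show ?thesis using assms by simp
qed

text \<open>A boundary pole of \<open>p\<close> at \<open>x\<close> is, up to a remainder that is nontangentially
  negligible, the largest multiple of the Cayley transform whose removal keeps the real part
  nonnegative.\<close>

lemma Julia_Wolff_half_plane:
  assumes p: "p holomorphic_on \<D>" "\<And>z. z \<in> \<D> \<Longrightarrow> Re (p z) \<ge> 0" and x: "cmod x = 1"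
  shows "\<exists>c. nt_limit (\<lambda>z. (x - z) * p z) x c"
proof -
  define K where "K = (\<lambda>z. (x + z) / (x - z))"
  \<comment> \<open>The infimum form supplies points \<open>w\<close> at which \<open>Re p\<close>
    is almost equal to \<open>a * Re K\<close>.\<close>
  define a where "a = (INF z\<in>\<D>. Re (p z) / Re (K z))"
  have xD: "z \<noteq> x" if "z \<in> \<D>" for z using that x by auto
  have ReK: "Re (K z) = (1 - (cmod z)\<^sup>2) / (cmod (x - z))\<^sup>2" if "z \<in> \<D>" for z
    unfolding K_def using Re_Cayley x xD that by blast
  have Kpos: "Re (K z) > 0" if "z \<in> \<D>" for z
    using ReK[OF that] that xD[OF that] by (simp add: abs_square_less_1)
  have K: "K holomorphic_on \<D>" unfolding K_def by (intro holomorphic_intros) (use xD in auto)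
  have bdd: "bdd_below ((\<lambda>z. Re (p z) / Re (K z)) ` \<D>)"
    using divide_nonneg_pos[OF p(2) Kpos] by (intro bdd_belowI[of _ 0]) blast
  have lim: "((\<lambda>z. (x - z) * p z - a * (x + z)) \<longlongrightarrow> 0) (at x within stolz_angle x R)"
    if R: "R > 1" for R
  proof (rule tendstoI)
    fix e :: real assume "e > 0"
    \<comment> \<open>The final estimate costs \<open>16 * R * d + d\<close> for the term with
      \<open>q\<close> and \<open>2 * d\<close> for \<open>d * (x + z)\<close>, together less than
      \<open>e\<close>.\<close>
    define d where "d = e / (16 * R + 4)"
    have "d * (16 * R + 4) = e" using R by (simp add: d_def)
    then have d: "16 * R * d + 4 * d = e" "d > 0"
      using \<open>e > 0\<close> R by (simp add: algebra_simps, simp add: d_def)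
    \<comment> \<open>Removing \<open>a - d\<close> instead of \<open>a\<close> makes
      \<open>Re q\<close> strictly positive, as Schwarz-Pick requires, while at a near-minimizer
      \<open>w\<close> it stays below \<open>2 * d * Re (K w)\<close>.\<close>
    define q where "q = (\<lambda>z. p z - (a - d) * K z)"
    have "\<exists>w\<in>\<D>. Re (p w) / Re (K w) < a + d"
    proof (rule ccontr)
      assume "\<not> ?thesis"
      then have "a + d \<le> a" unfolding a_def by (intro cINF_greatest) (auto simp: not_less a_def)
      then show False using d by simp
    qed
    then obtain w where w: "w \<in> \<D>" and pw: "Re (p w) < (a + d) * Re (K w)"
      using Kpos by (auto simp: divide_less_eq)
    have qw: "Re (q w) < 2 * d * Re (K w)" using pw by (simp add: q_def algebra_simps)
    have qpos: "Re (q z) > 0" if "z \<in> \<D>" for z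
    proof -
      have "a \<le> Re (p z) / Re (K z)" unfolding a_def by (rule cINF_lower[OF bdd that])
      then have "a * Re (K z) \<le> Re (p z)" using Kpos[OF that] by (simp add: le_divide_eq)
      moreover have "d * Re (K z) > 0" using Kpos[OF that] d by simp
      ultimately show ?thesis by (simp add: q_def algebra_simps)
    qed
    have q: "q holomorphic_on \<D>" unfolding q_def by (intro holomorphic_intros p K)
    have xw: "cmod (x - w) > 0" using xD[OF w] by auto
    \<comment> \<open>\<open>M x = 1\<close> because \<open>x\<close> is unimodular, so
      \<open>M z < 2\<close> holds near \<open>x\<close> whatever \<open>w\<close> is.\<close>
    define M where "M = (\<lambda>z. (cmod (1 - cnj w * z))\<^sup>2 / (cmod (x - w))\<^sup>2)"
    have "cmod (1 - cnj w * x) = cmod (x - w)"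
    proof -
      have "x * cnj x = 1" using x by (simp add: complex_norm_square[symmetric])
      then have "1 - cnj w * x = x * cnj (x - w)" by (simp add: algebra_simps)
      then show ?thesis using x by (simp only: norm_mult complex_mod_cnj)
    qed
    then have M: "M x < 2" using xw by (simp add: M_def)
    have "isCont M x" unfolding M_def using xw by (intro continuous_intros) auto
    then have "(M \<longlongrightarrow> M x) (at x within stolz_angle x R)"
      by (auto simp: isCont_def intro: tendsto_within_subset)
    then have evM: "eventually (\<lambda>z. M z < 2) (at x within stolz_angle x R)"
      using M by (rule order_tendstoD)
    have "((\<lambda>z. cmod (x - z) * cmod (q w)) \<longlongrightarrow> cmod (x - x) * cmod (q w)) (at x within stolz_angle x R)"
      by (intro tendsto_intros)
    then have evq: "eventually (\<lambda>z. cmod (x - z) * cmod (q w) < d) (at x within stolz_angle x R)"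
      using d by (intro order_tendstoD) auto
    show "\<forall>\<^sub>F z in at x within stolz_angle x R. dist ((x - z) * p z - a * (x + z)) 0 < e"
      using evM evq eventually_stolz_angle[of x R]
    proof eventually_elim
      case (elim z)
      have z: "z \<in> \<D>" "cmod (x - z) < R * (1 - cmod z)" using elim by (auto simp: stolz_angle_def)
      define P where "P = cmod (q z + cnj (q w))"
      have w1: "1 - (cmod w)\<^sup>2 > 0" using w by (simp add: abs_square_less_1)
      have "P * (1 - (cmod z)\<^sup>2) * (1 - (cmod w)\<^sup>2) \<le> 4 * Re (q w) * (cmod (1 - cnj w * z))\<^sup>2"
        using half_plane_growth[OF q qpos z(1) w] by (simp add: P_def mult.assoc)
      also have "\<dots> \<le> 4 * (2 * d * Re (K w)) * (cmod (1 - cnj w * z))\<^sup>2"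
        using qw by (intro mult_right_mono mult_left_mono) auto
      \<comment> \<open>The Poisson kernel at \<open>w\<close> contributes the factor
        \<open>1 - (cmod w)\<^sup>2\<close>, which cancels the one on the left; the resulting bound
        does not deteriorate when \<open>w\<close> is close to the circle.\<close>
      also have "\<dots> = 8 * d * M z * (1 - (cmod w)\<^sup>2)" using ReK[OF w] by (simp add: M_def)
      finally have "P * (1 - (cmod z)\<^sup>2) \<le> 8 * d * M z" using w1 by simp
      also have "\<dots> \<le> 16 * d" using elim d by simp
      finally have 1: "P * (1 - (cmod z)\<^sup>2) \<le> 16 * d" .
      have "P * (1 - cmod z) \<le> P * (1 - (cmod z)\<^sup>2)"
      proof -
        have "(cmod z)\<^sup>2 \<le> cmod z" using z by (simp add: power2_eq_square mult_left_le)
        then show ?thesis by (intro mult_left_mono) (auto simp: P_def)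
      qed
      with 1 have 2: "P * (1 - cmod z) \<le> 16 * d" by linarith
      have "cmod ((x - z) * q z) = cmod ((x - z) * (q z + cnj (q w)) - (x - z) * cnj (q w))"
        by (simp add: algebra_simps)
      also have "\<dots> \<le> cmod (x - z) * P + cmod (x - z) * cmod (q w)"
        by (rule order_trans[OF norm_triangle_ineq4]) (simp add: norm_mult P_def)
      also have "cmod (x - z) * P \<le> R * (1 - cmod z) * P"
        using z by (intro mult_right_mono) (auto simp: P_def)
      also have "\<dots> \<le> R * (16 * d)" using 2 R by (simp add: mult.assoc mult.commute)
      finally have 3: "cmod ((x - z) * q z) < 16 * R * d + d" using elim by simp
      \<comment> \<open>Multiplication by \<open>x - z\<close> turns the Cayley transform
        \<open>K z\<close> into \<open>x + z\<close>.\<close>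
      have "(x - z) * p z - a * (x + z) = (x - z) * q z - d * (x + z)"
        using xD[OF z(1)] by (simp add: q_def K_def field_simps)
      then have "cmod ((x - z) * p z - a * (x + z)) \<le> cmod ((x - z) * q z) + d * cmod (x + z)"
        using norm_triangle_ineq4[of "(x - z) * q z" "d * (x + z)"] d by (simp add: norm_mult)
      moreover have "cmod (x + z) \<le> 2" using norm_triangle_ineq[of x z] x z by simp
      then have "d * cmod (x + z) \<le> d * 2" using d by (intro mult_left_mono) auto
      ultimately have "cmod ((x - z) * p z - a * (x + z)) < e" using 3 d by linarith
      then show ?case by simp
    qed
  qed
  have "nt_limit (\<lambda>z. (x - z) * p z) x (a * (x + x))"
  proof (rule nt_limitI)
    fix R :: real assume "R > 1"
    have "((\<lambda>z. ((x - z) * p z - a * (x + z)) + a * (x + z)) \<longlongrightarrow> 0 + a * (x + x))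
      (at x within stolz_angle x R)"
      by (intro tendsto_add lim[OF \<open>R > 1\<close>] tendsto_intros)
    then show "((\<lambda>z. (x - z) * p z) \<longlongrightarrow> a * (x + x)) (at x within stolz_angle x R)" by simp
  qed
  then show ?thesis ..
qed

subsection \<open>Boundary behaviour of functions with controlled derivative\<close>

text \<open>On a convex set a bounded derivative gives a Lipschitz bound, hence uniform continuity
  and a continuous extension to the closure.\<close>

lemma tendsto_if_bounded_deriv:
  assumes U: "convex U" "open U" "x \<in> closure U" and f: "f holomorphic_on U"
    and B: "\<And>z. z \<in> U \<Longrightarrow> cmod (deriv f z) \<le> B"
  obtains l where "(f \<longlongrightarrow> l) (at x within U)"
proof -
  have "B \<ge> 0"
  proof -
    obtain u where "u \<in> U" using U(3) by fastforce
    then show ?thesis using B[of u] norm_ge_zero order_trans by blast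
  qed
  have "B-lipschitz_on U f"
  proof (rule lipschitz_onI)
    fix u v assume "u \<in> U" "v \<in> U"
    then show "dist (f u) (f v) \<le> B * dist u v" unfolding dist_norm
      by (intro field_differentiable_bound[OF U(1), of f "deriv f"] B)
        (auto intro: has_field_derivative_at_within holomorphic_derivI[OF f U(2)])
  qed fact
  then show ?thesis
    using uniformly_continuous_on_extension_at_closure[OF lipschitz_on_uniformly_continuous U(3)] that
    by blast
qed

text \<open>Bounds derived from nontangential limits hold only close to \<open>x\<close>; truncating
  the angle there keeps it convex and open and leaves the filter at \<open>x\<close>
  unchanged.\<close>

lemma stolz_angle_Int_ball:
  assumes "cmod x = 1" "R > 1" "d > 0"
  shows "convex (stolz_angle x R \<inter> ball x d)" "open (stolz_angle x R \<inter> ball x d)"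
    "x \<in> closure (stolz_angle x R \<inter> ball x d)"
    "at x within (stolz_angle x R \<inter> ball x d) = at x within stolz_angle x R"
proof -
  show "convex (stolz_angle x R \<inter> ball x d)" using assms by (intro convex_Int convex_stolz_angle) auto
  show "open (stolz_angle x R \<inter> ball x d)" by (intro open_Int open_stolz_angle open_ball)
  show eq: "at x within (stolz_angle x R \<inter> ball x d) = at x within stolz_angle x R"
    using assms by (intro at_within_nhd[of x "ball x d"]) auto
  have "x islimpt (stolz_angle x R \<inter> ball x d)"
    using stolz_angle_nontrivial[OF assms(1,2)] unfolding eq[symmetric] by (simp add: trivial_limit_within)
  then show "x \<in> closure (stolz_angle x R \<inter> ball x d)" by (simp add: closure_def)
qed

text \<open>Stolz angles are nested and their filters at \<open>x\<close> are nontrivial, so limits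
  found separately in each angle agree; \<open>R = 2\<close> serves as the reference.\<close>

lemma nt_limit_exI:
  assumes x: "cmod x = 1"
    and lim: "\<And>R. R > 1 \<Longrightarrow> \<exists>l. (f \<longlongrightarrow> l) (at x within stolz_angle x R)"
  shows "\<exists>l. nt_limit f x l"
proof -
  obtain l where l: "\<And>R. R > 1 \<Longrightarrow> (f \<longlongrightarrow> l R) (at x within stolz_angle x R)" using lim by metis
  have eq: "l R = l S" if "R > 1" "R \<le> S" for R S
  proof (rule tendsto_unique[OF stolz_angle_nontrivial[OF x that(1)] l[OF that(1)]])
    show "(f \<longlongrightarrow> l S) (at x within stolz_angle x R)"
      using that by (intro tendsto_within_subset[OF l stolz_angle_mono]) auto
  qed
  have "l R = l 2" if "R > 1" for R
    using eq[of R 2] eq[of 2 R] that by (cases "R \<le> 2") simp_all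
  then have "nt_limit f x (l 2)" using l by (intro nt_limitI) metis
  then show ?thesis ..
qed

lemma nt_bounded:
  assumes "nt_limit f x l" "R > 1"
  obtains d where "d > 0" "\<And>z. z \<in> stolz_angle x R \<inter> ball x d \<Longrightarrow> z \<noteq> x \<Longrightarrow> cmod (f z) < cmod l + 1"
proof -
  have "((\<lambda>z. cmod (f z)) \<longlongrightarrow> cmod l) (at x within stolz_angle x R)"
    by (intro tendsto_norm nt_limitD assms)
  then have "eventually (\<lambda>z. cmod (f z) < cmod l + 1) (at x within stolz_angle x R)"
    by (rule order_tendstoD) simp
  then show ?thesis using that unfolding eventually_at by (auto simp: dist_commute)
qed

lemma nt_limit_if_deriv_nt_limit:
  assumes x: "cmod x = 1" and f: "f holomorphic_on \<D>" and lim: "nt_limit (deriv f) x c"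
  shows "\<exists>l. nt_limit f x l"
proof (rule nt_limit_exI[OF x])
  fix R :: real assume R: "R > 1"
  obtain d where d: "d > 0"
    "\<And>z. z \<in> stolz_angle x R \<inter> ball x d \<Longrightarrow> z \<noteq> x \<Longrightarrow> cmod (deriv f z) < cmod c + 1"
    using nt_bounded[OF lim R] by blast
  note U = stolz_angle_Int_ball[OF x R d(1)]
  have UD: "stolz_angle x R \<inter> ball x d \<subseteq> \<D> - {x}" using x by (auto simp: stolz_angle_def)
  obtain l where "(f \<longlongrightarrow> l) (at x within (stolz_angle x R \<inter> ball x d))"
  proof (rule tendsto_if_bounded_deriv[OF U(1-3)])
    show "f holomorphic_on stolz_angle x R \<inter> ball x d"
      using f UD holomorphic_on_subset by blast
    show "cmod (deriv f z) \<le> cmod c + 1" if "z \<in> stolz_angle x R \<inter> ball x d" for z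
      using d(2)[OF that] UD that by force
  qed
  then show "\<exists>l. (f \<longlongrightarrow> l) (at x within stolz_angle x R)" unfolding U(4) ..
qed

text \<open>The equation for an interior Denjoy-Wolff point controls only \<open>h' / h\<close>. On
  a truncated angle, which is convex, \<open>h = exp g\<close> with \<open>g' = h' / h\<close>
  bounded; so \<open>g\<close> converges and with it \<open>h\<close>.\<close>

lemma nt_limit_if_log_deriv_nt_limit:
  assumes x: "cmod x = 1" and h: "h holomorphic_on \<D>"
    and nz: "eventually (\<lambda>z. h z \<noteq> 0) (at x within \<D>)"
    and lim: "nt_limit (\<lambda>z. deriv h z / h z) x c"
  shows "\<exists>l. nt_limit h x l"
proof (rule nt_limit_exI[OF x])
  fix R :: real assume R: "R > 1"
  obtain e where e: "e > 0" "\<And>z. z \<in> \<D> \<Longrightarrow> z \<in> ball x e \<Longrightarrow> z \<noteq> x \<Longrightarrow> h z \<noteq> 0"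
    using nz unfolding eventually_at by (auto simp: dist_commute)
  obtain d' where d': "d' > 0"
    "\<And>z. z \<in> stolz_angle x R \<inter> ball x d' \<Longrightarrow> z \<noteq> x \<Longrightarrow> cmod (deriv h z / h z) < cmod c + 1"
    using nt_bounded[OF lim R] by blast
  define d where "d = min e d'"
  have d: "d > 0" using e d' by (simp add: d_def)
  define U where "U = stolz_angle x R \<inter> ball x d"
  note Up = stolz_angle_Int_ball[OF x R d, folded U_def]
  have UD: "U \<subseteq> \<D> - {x}" using x by (auto simp: U_def stolz_angle_def)
  have hU: "h holomorphic_on U" using h UD holomorphic_on_subset by blast
  have nzU: "h z \<noteq> 0" if "z \<in> U" for z
    proof (rule e(2))
    show "z \<in> \<D>" "z \<noteq> x" using that UD by auto
    show "z \<in> ball x e" using that by (simp add: U_def d_def)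
  qed
  obtain g where g: "g holomorphic_on U" "\<And>z. z \<in> U \<Longrightarrow> h z = exp (g z)"
    using contractible_imp_holomorphic_log[OF hU convex_imp_contractible[OF Up(1)] nzU] by metis
  obtain l where l: "(g \<longlongrightarrow> l) (at x within U)"
  proof (rule tendsto_if_bounded_deriv[OF Up(1-3) g(1)])
    show "cmod (deriv g z) \<le> cmod c + 1" if z: "z \<in> U" for z
    proof -
      have "((\<lambda>w. exp (g w)) has_field_derivative exp (g z) * deriv g z) (at z)"
        by (intro DERIV_chain2[OF DERIV_exp] holomorphic_derivI[OF g(1) Up(2) z])
      then have "(h has_field_derivative exp (g z) * deriv g z) (at z)"
        using has_field_derivative_transform_within_open[OF _ Up(2) z, of _ _ h] g(2) by force
      then have "deriv h z = h z * deriv g z" using g(2)[OF z] by (simp add: DERIV_imp_deriv)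
      then have "deriv g z = deriv h z / h z" using nzU[OF z] by simp
      then show ?thesis using d'(2)[of z] z UD by (force simp: U_def d_def)
    qed
  qed
  have "((\<lambda>z. exp (g z)) \<longlongrightarrow> exp l) (at x within U)" by (intro tendsto_intros l)
  then have "(h \<longlongrightarrow> exp l) (at x within U)"
    by (rule Lim_transform_eventually) (auto simp: eventually_at_filter g(2))
  then show "\<exists>l. (h \<longlongrightarrow> l) (at x within stolz_angle x R)" unfolding Up(4) ..
qed

text \<open>Supplies discs for Cauchy's estimate. With half the distance to the circle as radius,
  \<open>1 - cmod w\<close> is at least \<open>(1 - cmod z) / 2\<close>, and the triangle inequality
  gives the aperture \<open>2 * R + 1\<close>.\<close>

lemma cball_subset_stolz_angle:
  assumes z: "z \<in> stolz_angle x R" and w: "w \<in> cball z ((1 - cmod z) / 2)" and x: "cmod x = 1"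
  shows "w \<in> stolz_angle x (2 * R + 1)" and "cmod (x - w) \<le> 2 * cmod (x - z)"
proof -
  have z': "cmod z < 1" "cmod (x - z) < R * (1 - cmod z)" using z by (auto simp: stolz_angle_def)
  have zw: "cmod (z - w) \<le> (1 - cmod z) / 2" using w by (simp add: dist_norm)
  have xw: "cmod (x - w) \<le> cmod (x - z) + cmod (z - w)"
    using norm_triangle_ineq[of "x - z" "z - w"] by simp
  have wz: "cmod w \<le> cmod z + cmod (z - w)"
    using norm_triangle_ineq[of z "w - z"] by (simp add: norm_minus_commute)
  have "0 < R * (1 - cmod z)" using z' norm_ge_zero[of "x - z"] by linarith
  then have "R > 0" using z' by (simp add: zero_less_mult_iff)
  have "(2 * R + 1) * ((1 - cmod z) / 2) \<le> (2 * R + 1) * (1 - cmod w)"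
    using wz zw \<open>R > 0\<close> by (intro mult_left_mono) (auto simp: field_simps)
  moreover have "(2 * R + 1) * ((1 - cmod z) / 2) = R * (1 - cmod z) + (1 - cmod z) / 2"
    by (simp add: field_simps)
  ultimately have "cmod (x - w) < (2 * R + 1) * (1 - cmod w)" using xw zw z'(2) by linarith
  moreover have "cmod w < 1" using wz zw z'(1) by (simp add: field_simps)
  ultimately show "w \<in> stolz_angle x (2 * R + 1)" by (simp add: stolz_angle_def)
  have "1 - cmod z \<le> cmod (x - z)" using norm_triangle_ineq2[of x z] x by simp
  then show "cmod (x - w) \<le> 2 * cmod (x - z)" using zw xw z' by (auto simp: field_simps)
qed

text \<open>Writing \<open>f = (z - x) * k\<close> gives \<open>f' = k + (z - x) * k'\<close>. The
  last term vanishes in the limit by Cauchy's estimate, since in a Stolz angle the radius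
  \<open>(1 - cmod z) / 2\<close> is comparable to \<open>cmod (x - z)\<close>.\<close>

lemma nt_limit_deriv:
  assumes x: "cmod x = 1" and f: "f holomorphic_on \<D>"
    and lim: "nt_limit (\<lambda>z. f z / (z - x)) x L"
  shows "nt_limit (deriv f) x L"
proof (rule nt_limitI)
  fix R :: real assume R: "R > 1"
  define k where "k = (\<lambda>z. f z / (z - x))"
  have xD: "z \<noteq> x" if "z \<in> \<D>" for z using that x by auto
  have k: "k holomorphic_on \<D>" unfolding k_def by (intro holomorphic_intros f) (use xD in auto)
  have "((\<lambda>z. (z - x) * deriv k z) \<longlongrightarrow> 0) (at x within stolz_angle x R)"
  proof (rule tendstoI)
    fix e :: real assume e: "e > 0"
    \<comment> \<open>Cauchy's estimate gives \<open>d / r\<close> for \<open>k'\<close>; multiplied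
      by \<open>R * (1 - cmod z) = 2 * R * r\<close> this is
      \<open>2 * R * d = e / 2\<close>.\<close>
    define d where "d = e / (4 * R)"
    have d: "d > 0" using e R by (simp add: d_def)
    have "(k \<longlongrightarrow> L) (at x within stolz_angle x (2 * R + 1))"
      unfolding k_def using nt_limitD[OF lim] R by simp
    from tendstoD[OF this d] obtain s where s: "s > 0"
      "\<And>w. w \<in> stolz_angle x (2 * R + 1) \<Longrightarrow> w \<noteq> x \<Longrightarrow> cmod (x - w) < s \<Longrightarrow> cmod (k w - L) < d"
      unfolding eventually_at by (auto simp: dist_norm norm_minus_commute)
    have "((\<lambda>z. cmod (x - z)) \<longlongrightarrow> cmod (x - x)) (at x within stolz_angle x R)" by (intro tendsto_intros)
    \<comment> \<open>Points of the disc around \<open>z\<close> may be twice as far from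
      \<open>x\<close> as \<open>z\<close> is, hence \<open>s / 2\<close>.\<close>
    then have "eventually (\<lambda>z. cmod (x - z) < s / 2) (at x within stolz_angle x R)"
      using s(1) by (intro order_tendstoD) auto
    then show "\<forall>\<^sub>F z in at x within stolz_angle x R. dist ((z - x) * deriv k z) 0 < e"
      using eventually_stolz_angle[of x R]
    proof eventually_elim
      case (elim z)
      define r where "r = (1 - cmod z) / 2"
      have z: "cmod z < 1" "cmod (x - z) < R * (1 - cmod z)" using elim by (auto simp: stolz_angle_def)
      have sub: "w \<in> stolz_angle x (2 * R + 1)" "cmod (x - w) < s" if "w \<in> cball z r" for w
        using cball_subset_stolz_angle[OF elim(2) that[unfolded r_def] x] elim(1) by auto
      then have subD: "cball z r \<subseteq> \<D>" by (auto simp: stolz_angle_def)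
      have kr: "(\<lambda>w. k w - L) holomorphic_on cball z r"
        using k subD by (intro holomorphic_intros) (rule holomorphic_on_subset)
      \<comment> \<open>Subtracting \<open>L\<close> leaves the derivative unchanged but makes the
        function small on the circle, where \<open>k\<close> alone would only be bounded.\<close>
      have "cmod ((deriv ^^ 1) (\<lambda>w. k w - L) z) \<le> fact 1 * d / r ^ 1"
      proof (rule Cauchy_inequality)
        show "(\<lambda>w. k w - L) holomorphic_on ball z r"
          using kr ball_subset_cball holomorphic_on_subset by blast
        show "continuous_on (cball z r) (\<lambda>w. k w - L)" by (rule holomorphic_on_imp_continuous_on[OF kr])
        show "r > 0" using z by (simp add: r_def)
        show "cmod (k w - L) \<le> d" if "cmod (z - w) = r" for w
        proof -
          have w: "w \<in> cball z r" using that by (simp add: dist_norm)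
          then have "w \<noteq> x" using xD subD by blast
          from s(2)[OF sub(1)[OF w] this sub(2)[OF w]] show ?thesis by simp
        qed
      qed
      moreover have "deriv (\<lambda>w. k w - L) z = deriv k z"
      proof -
        have "(k has_field_derivative deriv k z) (at z)"
          using holomorphic_derivI[OF k open_ball] z by simp
        then have "((\<lambda>w. k w - L) has_field_derivative deriv k z - 0) (at z)"
          by (intro derivative_intros)
        then show ?thesis by (simp add: DERIV_imp_deriv)
      qed
      ultimately have "cmod (deriv k z) \<le> d / r" by simp
      then have "cmod (x - z) * cmod (deriv k z) \<le> R * (1 - cmod z) * (d / r)"
        using z R by (intro mult_mono) auto
      also have "\<dots> = e / 2" using z R by (simp add: r_def d_def field_simps)
      also have "\<dots> < e" using e by simp
      finally show ?case by (simp add: norm_mult norm_minus_commute)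
    qed
  qed
  moreover have "(k \<longlongrightarrow> L) (at x within stolz_angle x R)"
    unfolding k_def by (rule nt_limitD[OF lim R])
  ultimately have "((\<lambda>z. k z + (z - x) * deriv k z) \<longlongrightarrow> L + 0) (at x within stolz_angle x R)"
    by (intro tendsto_add)
  moreover have "eventually (\<lambda>z. k z + (z - x) * deriv k z = deriv f z) (at x within stolz_angle x R)"
  proof (rule eventually_mono[OF eventually_stolz_angle])
    fix z assume "z \<in> stolz_angle x R"
    then have z: "z \<in> \<D>" by (simp add: stolz_angle_def)
    have "((\<lambda>w. (w - x) * k w) has_field_derivative (k z + (z - x) * deriv k z)) (at z)"
      by (rule derivative_eq_intros holomorphic_derivI[OF k open_ball z] refl)+ simp
    then have "(f has_field_derivative (k z + (z - x) * deriv k z)) (at z)"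
      by (rule has_field_derivative_transform_within_open[OF _ open_ball z])
        (use xD in \<open>auto simp: k_def\<close>)
    then show "k z + (z - x) * deriv k z = deriv f z" by (simp add: DERIV_imp_deriv)
  qed
  ultimately show "(deriv f \<longlongrightarrow> L) (at x within stolz_angle x R)"
    by (auto intro: Lim_transform_eventually)
qed

section \<open>Extended-real lower and upper limits\<close>

lemma ereal_less_infty_bound:
  assumes "(L::ereal) < \<infinity>"
  obtains M :: real where "M > 0" "L < ereal M"
proof -
  obtain n :: nat where "L < ereal (real n)"
    using assms less_PInf_Ex_of_nat[of L] by auto
  then have "L < ereal (real n + 1)" by (rule less_trans) simp
  then show ?thesis using that[of "real n + 1"] by simp
qed

lemma Liminf_less_infty_if_eventually_le:
  assumes "eventually (\<lambda>r. f r \<le> M) F" "F \<noteq> bot"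
  shows "Liminf F (\<lambda>r. ereal (f r)) < \<infinity>"
proof -
  have "Liminf F (\<lambda>r. ereal (f r)) \<le> Limsup F (\<lambda>r. ereal (f r))" by (rule Liminf_le_Limsup[OF assms(2)])
  also have "\<dots> \<le> ereal M" by (rule Limsup_bounded) (use assms(1) in simp)
  also have "\<dots> < \<infinity>" by simp
  finally show ?thesis .
qed

lemma nt_Liminf_eq:
  assumes "cmod x = 1" "nt_limit f x l"
  shows "nt_Liminf (\<lambda>z. ereal (cmod (f z))) x = ereal (cmod l)"
proof -
  have "Liminf (at x within stolz_angle x R) (\<lambda>z. ereal (cmod (f z))) = ereal (cmod l)" if "R > 1" for R
    using that assms by (intro lim_imp_Liminf stolz_angle_nontrivial tendsto_ereal tendsto_norm nt_limitD)
  then have "nt_Liminf (\<lambda>z. ereal (cmod (f z))) x = (INF R\<in>{1::real<..}. ereal (cmod l))"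
    unfolding nt_Liminf_def by (intro INF_cong) auto
  then show ?thesis by simp
qed

lemma nt_Limsup_eq:
  assumes "cmod x = 1" "nt_limit f x l"
  shows "nt_Limsup (\<lambda>z. ereal (cmod (f z))) x = ereal (cmod l)"
proof -
  have "Limsup (at x within stolz_angle x R) (\<lambda>z. ereal (cmod (f z))) = ereal (cmod l)" if "R > 1" for R
    using that assms by (intro lim_imp_Limsup stolz_angle_nontrivial tendsto_ereal tendsto_norm nt_limitD)
  then have "nt_Limsup (\<lambda>z. ereal (cmod (f z))) x = (SUP R\<in>{1::real<..}. ereal (cmod l))"
    unfolding nt_Limsup_def by (intro SUP_cong) auto
  then show ?thesis by simp
qed

subsection \<open>Generators and Koenigs functions at a boundary point\<close>

text \<open>Because the limit exists in every angle, the lower limit is just its modulus; positivity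
  of the mass becomes \<open>A \<noteq> 0\<close>.\<close>

lemma regular_pole_of_mass_iff:
  assumes "cmod x = 1" "nt_limit (\<lambda>z. G z * (z - x)) x A"
  shows "regular_pole_of_mass G x C \<longleftrightarrow> C = cmod A \<and> A \<noteq> 0"
proof -
  have "nt_Liminf (\<lambda>z. ereal (cmod (G z * (x - z)))) x = ereal (cmod A)"
    using nt_Liminf_eq[OF assms] by (simp add: norm_mult norm_minus_commute)
  then show ?thesis by (auto simp: regular_pole_of_mass_def)
qed

text \<open>The Berkson-Porta factor in front of \<open>p\<close> is continuous at \<open>x\<close>,
  so it only multiplies the Julia-Wolff limit of \<open>(x - z) * p z\<close>; the minus sign
  accounts for \<open>z - x\<close>. For \<open>\<tau> = x\<close> the limit is
  \<open>0\<close>.\<close>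

lemma nt_limit_generator:
  assumes "denjoy_wolff_point G \<tau>" and x: "cmod x = 1"
  shows "\<exists>A. nt_limit (\<lambda>z. G z * (z - x)) x A"
proof -
  obtain p where p: "p holomorphic_on \<D>" "\<And>z. z \<in> \<D> \<Longrightarrow> Re (p z) \<ge> 0"
    "\<And>z. z \<in> \<D> \<Longrightarrow> G z = (z - \<tau>) * (cnj \<tau> * z - 1) * p z"
    using assms(1) unfolding denjoy_wolff_point_def by blast
  obtain c where c: "nt_limit (\<lambda>z. (x - z) * p z) x c"
    using Julia_Wolff_half_plane[OF p(1,2) x] by blast
  have "nt_limit (\<lambda>z. (- ((z - \<tau>) * (cnj \<tau> * z - 1))) * ((x - z) * p z)) x
          ((- ((x - \<tau>) * (cnj \<tau> * x - 1))) * c)"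
    by (rule nt_limit_mult[OF nt_limit_continuous c]) (intro continuous_intros)
  moreover have "(- ((z - \<tau>) * (cnj \<tau> * z - 1))) * ((x - z) * p z) = G z * (z - x)" if "z \<in> \<D>" for z
    unfolding p(3)[OF that] by (simp add: algebra_simps)
  ultimately have "nt_limit (\<lambda>z. G z * (z - x)) x ((- ((x - \<tau>) * (cnj \<tau> * x - 1))) * c)"
    by (rule nt_limit_cong[THEN iffD1, rotated])
  then show ?thesis ..
qed

section \<open>Radial growth of \<open>h'\<close> and regular poles\<close>

lemma Liminf_radial_if_beta_point:
  assumes x: "cmod x = 1" and b: "beta_point h x"
  shows "Liminf (at_left 1) (\<lambda>r::real. ereal (cmod (deriv h (of_real r * x)) / (1 - r))) < \<infinity>"
proof -
  \<comment> \<open>One angle suffices, since each contains the radius, where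
    \<open>cmod (x - z)\<close> equals \<open>1 - r\<close>.\<close>
  have "Limsup (at x within stolz_angle x 2) (\<lambda>z. ereal (cmod (deriv h z) / cmod (x - z)))
      \<le> nt_Limsup (\<lambda>z. ereal (cmod (deriv h z) / cmod (x - z))) x"
    unfolding nt_Limsup_def
    using SUP_upper[of 2 "{1::real<..}" "\<lambda>R. Limsup (at x within stolz_angle x R) (\<lambda>z. ereal (cmod (deriv h z) / cmod (x - z)))"]
    by simp
  also have "\<dots> < \<infinity>" using b by (simp add: beta_point_def)
  finally obtain M where "Limsup (at x within stolz_angle x 2) (\<lambda>z. ereal (cmod (deriv h z) / cmod (x - z))) < ereal M"
    by (rule ereal_less_infty_bound)
  then have "eventually (\<lambda>z. ereal (cmod (deriv h z) / cmod (x - z)) < ereal M) (at x within stolz_angle x 2)"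
    by (rule Limsup_lessD)
  from eventually_compose_filterlim[OF this filterlim_radius_stolz_angle[OF x]]
  have "eventually (\<lambda>r::real. ereal (cmod (deriv h (of_real r * x)) / cmod (x - of_real r * x)) < ereal M) (at_left 1)"
    by simp
  then have "eventually (\<lambda>r::real. cmod (deriv h (of_real r * x)) / (1 - r) \<le> M) (at_left 1)"
    using eventually_radius
  proof eventually_elim
    case (elim r)
    then show ?case using cmod_radius_diff(2)[of x r] x by simp
  qed
  then show ?thesis by (rule Liminf_less_infty_if_eventually_le) (simp add: trivial_limit_at_left_real)
qed

text \<open>The mean value estimate on the radial segment from \<open>r\<close> to \<open>s\<close>,
  followed by \<open>s\<close> tending to \<open>1\<close> where \<open>h'\<close> vanishes, yields
  \<open>cmod (h' (r * x)) \<le> M * (1 - r)\<close>.\<close>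

lemma Liminf_radial_if_second_deriv_bounded:
  assumes x: "cmod x = 1" and h: "h holomorphic_on \<D>"
    and lim: "((\<lambda>r::real. cmod (deriv h (of_real r * x))) \<longlongrightarrow> 0) (at_left 1)"
    and bd: "Limsup (at_left 1) (\<lambda>r::real. ereal (cmod (deriv (deriv h) (of_real r * x)))) < \<infinity>"
  shows "Liminf (at_left 1) (\<lambda>r::real. ereal (cmod (deriv h (of_real r * x)) / (1 - r))) < \<infinity>"
proof -
  have h': "deriv h holomorphic_on \<D>" by (intro holomorphic_deriv h open_ball)
  obtain M where "M > 0" "Limsup (at_left 1) (\<lambda>r::real. ereal (cmod (deriv (deriv h) (of_real r * x)))) < ereal M"
    using ereal_less_infty_bound[OF bd] by blast
  then have "eventually (\<lambda>r::real. cmod (deriv (deriv h) (of_real r * x)) < M) (at_left 1)"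
    using Limsup_lessD by fastforce
  then obtain b where b: "b < 1" "\<And>r. b < r \<Longrightarrow> r < 1 \<Longrightarrow> cmod (deriv (deriv h) (of_real r * x)) < M"
    unfolding eventually_at_left_field by auto
  \<comment> \<open>A nonnegative lower end keeps the segments inside the disc; \<open>b\<close>
    itself could be very negative.\<close>
  define a where "a = max 0 b"
  have "a < 1" using b by (simp add: a_def)
  have bound: "cmod (deriv h (of_real r * x)) \<le> M * (1 - r)" if r: "a < r" "r < 1" for r
  proof -
    have *: "cmod (deriv h (of_real r * x)) \<le> M * (1 - r) + cmod (deriv h (of_real s * x))"
      if s: "r < s" "s < 1" for s
    proof -
      let ?I = "(\<lambda>t. of_real t * x) ` {r..s}"
      have "convex ?I"
        by (intro convex_linear_image linearI convex_real_interval)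
          (auto simp: algebra_simps scaleR_conv_of_real)
      have "cmod (deriv h (of_real r * x) - deriv h (of_real s * x)) \<le> M * cmod (of_real r * x - of_real s * x)"
      proof (rule field_differentiable_bound[OF \<open>convex ?I\<close>])
        fix z assume "z \<in> ?I"
        then obtain t where t: "t \<in> {r..s}" "z = of_real t * x" by blast
        then have "z \<in> \<D>" using r s x by (auto simp: norm_mult a_def)
        then show "(deriv h has_field_derivative deriv (deriv h) z) (at z within ?I)"
          using holomorphic_derivI[OF h' open_ball] has_field_derivative_at_within by blast
        show "cmod (deriv (deriv h) z) \<le> M" using b(2)[of t] t r s by (auto simp: a_def intro: less_imp_le)
      qed (use s in auto)
      also have "of_real r * x - of_real s * x = of_real (r - s) * x" by (simp add: algebra_simps)
      also have "cmod \<dots> = s - r" using x s by (simp only: norm_mult norm_of_real) auto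
      also have "M * (s - r) \<le> M * (1 - r)" using s \<open>M > 0\<close> by (intro mult_left_mono) auto
      finally show ?thesis
        using norm_triangle_sub[of "deriv h (of_real r * x)" "deriv h (of_real s * x)"] by linarith
    qed
    have "((\<lambda>s::real. M * (1 - r) + cmod (deriv h (of_real s * x))) \<longlongrightarrow> M * (1 - r) + 0) (at_left 1)"
      by (intro tendsto_intros lim)
    moreover have "eventually (\<lambda>s. cmod (deriv h (of_real r * x)) \<le> M * (1 - r) + cmod (deriv h (of_real s * x))) (at_left 1)"
      using eventually_at_left_real[OF r(2)] by (rule eventually_mono) (use * in auto)
    ultimately have "cmod (deriv h (of_real r * x)) \<le> M * (1 - r) + 0"
      by (rule tendsto_lowerbound) (simp add: trivial_limit_at_left_real)
    then show ?thesis by simp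
  qed
  have "eventually (\<lambda>r::real. cmod (deriv h (of_real r * x)) / (1 - r) \<le> M) (at_left 1)"
    using eventually_at_left_real[OF \<open>a < 1\<close>]
    by (rule eventually_mono) (use bound in \<open>auto simp: divide_le_eq\<close>)
  then show ?thesis by (rule Liminf_less_infty_if_eventually_le) (simp add: trivial_limit_at_left_real)
qed

text \<open>If \<open>A = 0\<close>, then \<open>G * (z - x)\<close> tends to \<open>0\<close> while
  \<open>h' * G\<close> stays at least \<open>e\<close> in modulus, so the radial quotient tends to
  infinity. Since this holds along the whole radius, a finite lower limit already contradicts
  it.\<close>

lemma regular_pole_if_Liminf_radial:
  assumes x: "cmod x = 1" and lim: "nt_limit (\<lambda>z. G z * (z - x)) x A"
    and N: "\<And>z. z \<in> \<D> \<Longrightarrow> deriv h z * G z = N z"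
    and e: "e > 0" "eventually (\<lambda>z. e \<le> cmod (N z)) (at x within \<D>)"
    and inf: "Liminf (at_left 1) (\<lambda>r::real. ereal (cmod (deriv h (of_real r * x)) / (1 - r))) < \<infinity>"
  shows "A \<noteq> 0"
proof
  assume "A = 0"
  define k where "k = (\<lambda>r::real. cmod (deriv h (of_real r * x)) / (1 - r))"
  obtain M where M: "M > 0" "Liminf (at_left 1) (\<lambda>r. ereal (k r)) < ereal M"
    using ereal_less_infty_bound[OF inf] unfolding k_def by blast
  have fl: "filterlim (\<lambda>r. of_real r * x) (at x within stolz_angle x 2) (at_left (1::real))"
    using filterlim_radius_stolz_angle x by simp
  have "((\<lambda>z. cmod (G z * (z - x))) \<longlongrightarrow> 0) (at x within stolz_angle x 2)"
    using nt_limitD[OF lim, of 2] \<open>A = 0\<close> by (intro tendsto_norm_zero) auto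
  \<comment> \<open>The threshold \<open>e / M\<close> forces the quotient \<open>k r\<close> to be
    at least \<open>M\<close>, which was chosen above its lower limit.\<close>
  then have "eventually (\<lambda>z. cmod (G z * (z - x)) < e / M) (at x within stolz_angle x 2)"
    using e M by (intro order_tendstoD) auto
  from eventually_compose_filterlim[OF this fl]
  have 1: "eventually (\<lambda>r::real. cmod (G (of_real r * x) * (of_real r * x - x)) < e / M) (at_left 1)" .
  have "at x within stolz_angle x 2 \<le> at x within \<D>" by (rule at_le) (auto simp: stolz_angle_def)
  then have "eventually (\<lambda>z. e \<le> cmod (N z)) (at x within stolz_angle x 2)"
    using e(2) by (rule filter_leD)
  from eventually_compose_filterlim[OF this fl]
  have "eventually (\<lambda>r::real. e \<le> cmod (N (of_real r * x))) (at_left 1)" .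
  then have "eventually (\<lambda>r. ereal M \<le> ereal (k r)) (at_left 1)"
    using 1 eventually_radius
  proof eventually_elim
    case (elim r)
    have "of_real r * x \<in> \<D>" using elim x by (simp add: norm_mult)
    then have "cmod (deriv h (of_real r * x)) * cmod (G (of_real r * x)) \<ge> e"
      using elim(1) N[of "of_real r * x"] by (metis norm_mult)
    moreover have g: "cmod (G (of_real r * x)) * (1 - r) < e / M"
      using elim cmod_radius_diff(1)[of x r] x by (simp add: norm_mult)
    ultimately have "e \<le> k r * (cmod (G (of_real r * x)) * (1 - r))"
      using elim by (simp add: k_def)
    also have "\<dots> \<le> k r * (e / M)"
      using g elim by (intro mult_left_mono) (auto simp: k_def)
    finally have "e * M \<le> e * k r" using M by (simp add: field_simps)
    then show ?case using e by simp
  qed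
  then have "ereal M \<le> Liminf (at_left 1) (\<lambda>r. ereal (k r))" by (rule Liminf_bounded)
  then show False using M by simp
qed

section \<open>Boundary limits of the Koenigs function\<close>

lemma nt_limit_deriv_div:
  assumes lim: "nt_limit (\<lambda>z. G z * (z - x)) x A" and A: "A \<noteq> 0"
    and N: "\<And>z. z \<in> \<D> \<Longrightarrow> deriv h z * G z = N z" and n: "nt_limit N x n"
  shows "nt_limit (\<lambda>z. deriv h z / (z - x)) x (n / A)"
proof (rule nt_limitI)
  fix R :: real assume R: "R > 1"
  have "((\<lambda>z. N z / (G z * (z - x))) \<longlongrightarrow> n / A) (at x within stolz_angle x R)"
    by (intro tendsto_divide nt_limitD[OF n R] nt_limitD[OF lim R] A)
  moreover have "eventually (\<lambda>z. N z / (G z * (z - x)) = deriv h z / (z - x)) (at x within stolz_angle x R)"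
    using tendsto_imp_eventually_ne[OF nt_limitD[OF lim R] A] eventually_stolz_angle[of x R]
  proof eventually_elim
    case (elim z)
    then have "N z = deriv h z * G z" using N by (simp add: stolz_angle_def)
    then show ?case using elim(1) by simp
  qed
  ultimately show "((\<lambda>z. deriv h z / (z - x)) \<longlongrightarrow> n / A) (at x within stolz_angle x R)"
    by (rule Lim_transform_eventually)
qed

text \<open>By the open mapping theorem the image of a small disc around the zero
  \<open>\<tau>\<close> covers some \<open>ball 0 e\<close>. Injectivity keeps all other points of
  the unit disc out of that ball, in particular those near \<open>x\<close>.\<close>

lemma inj_holomorphic_bounded_away:
  assumes h: "h holomorphic_on \<D>" "inj_on h \<D>" "\<tau> \<in> \<D>" "h \<tau> = 0" and x: "cmod x = 1"
  obtains e where "e > 0" "eventually (\<lambda>z. e \<le> cmod (h z)) (at x within \<D>)"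
proof -
  define r where "r = (1 - cmod \<tau>) / 2"
  have r: "r > 0" "cmod \<tau> + r < 1" using h by (auto simp: r_def field_simps)
  have sub: "ball \<tau> r \<subseteq> \<D>"
  proof
    fix z assume "z \<in> ball \<tau> r"
    then have "cmod (z - \<tau>) < r" by (simp add: dist_norm norm_minus_commute)
    then show "z \<in> \<D>" using r(2) norm_triangle_sub[of z \<tau>] by simp
  qed
  have "open (h ` ball \<tau> r)"
    by (rule open_mapping_thm3) (use h sub holomorphic_on_subset inj_on_subset in \<open>blast+\<close>)
  moreover have "0 \<in> h ` ball \<tau> r" using h(4) r by force
  ultimately obtain e where e: "e > 0" "ball 0 e \<subseteq> h ` ball \<tau> r" by (meson openE)
  have far: "e \<le> cmod (h z)" if z: "z \<in> \<D>" "z \<notin> ball \<tau> r" for z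
  proof (rule ccontr)
    assume "\<not> e \<le> cmod (h z)"
    then have "h z \<in> h ` ball \<tau> r" using e by auto
    then show False using inj_on_image_mem_iff[OF h(2) z(1) sub] z by simp
  qed
  have "x \<notin> cball \<tau> r" using x r norm_triangle_sub[of x \<tau>] by (auto simp: dist_norm norm_minus_commute)
  then have "eventually (\<lambda>z. z \<in> - cball \<tau> r) (at x within \<D>)"
    by (intro eventually_at_topological[THEN iffD2] exI[of _ "- cball \<tau> r"]) auto
  moreover have "eventually (\<lambda>z. z \<in> \<D>) (at x within \<D>)" by (simp add: eventually_at_filter)
  ultimately have "eventually (\<lambda>z. e \<le> cmod (h z)) (at x within \<D>)"
    by eventually_elim (use far in auto)
  then show ?thesis using that e by blast
qed

text \<open>Here \<open>h' / h = c / G\<close>; expanding by \<open>z - x\<close> shows that it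
  tends to \<open>0 / A\<close>, so the logarithmic derivative criterion applies. The lower bound
  \<open>e\<close> passes to the limit and makes it nonzero.\<close>

lemma nt_limit_koenigs_interior:
  assumes x: "cmod x = 1" and h: "h holomorphic_on \<D>"
    and lim: "nt_limit (\<lambda>z. G z * (z - x)) x A" and A: "A \<noteq> 0"
    and N: "\<And>z. z \<in> \<D> \<Longrightarrow> deriv h z * G z = c * h z"
    and e: "e > 0" "eventually (\<lambda>z. e \<le> cmod (h z)) (at x within \<D>)"
  shows "\<exists>l. l \<noteq> 0 \<and> nt_limit h x l"
proof -
  have nz: "eventually (\<lambda>z. h z \<noteq> 0) (at x within \<D>)"
    using e(2) by (rule eventually_mono) (use e(1) in auto)
  have le: "at x within stolz_angle x R \<le> at x within \<D>" for R
    by (rule at_le) (auto simp: stolz_angle_def)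
  have "nt_limit (\<lambda>z. deriv h z / h z) x 0"
  proof (rule nt_limitI)
    fix R :: real assume R: "R > 1"
    have "((\<lambda>z. c * (z - x) / (G z * (z - x))) \<longlongrightarrow> c * (x - x) / A) (at x within stolz_angle x R)"
      by (intro tendsto_intros nt_limitD[OF lim R] A)
    then have "((\<lambda>z. c * (z - x) / (G z * (z - x))) \<longlongrightarrow> 0) (at x within stolz_angle x R)" by simp
    moreover have "eventually (\<lambda>z. c * (z - x) / (G z * (z - x)) = deriv h z / h z) (at x within stolz_angle x R)"
      using tendsto_imp_eventually_ne[OF nt_limitD[OF lim R] A] eventually_stolz_angle[of x R] filter_leD[OF le nz]
    proof eventually_elim
      case (elim z)
      then have "deriv h z * G z = c * h z" using N by (simp add: stolz_angle_def)
      then show ?case using elim(1,3) by (simp add: field_simps)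
    qed
    ultimately show "((\<lambda>z. deriv h z / h z) \<longlongrightarrow> 0) (at x within stolz_angle x R)"
      by (rule Lim_transform_eventually)
  qed
  then obtain l where l: "nt_limit h x l" using nt_limit_if_log_deriv_nt_limit[OF x h nz] by blast
  have "e \<le> cmod l"
    by (rule tendsto_lowerbound[OF tendsto_norm[OF nt_limitD[OF l, of 2]] filter_leD[OF le e(2)]])
      (use stolz_angle_nontrivial[OF x] in auto)
  then have "l \<noteq> 0" using e(1) by auto
  then show ?thesis using l by blast
qed

text \<open>Merges the two positions of \<open>\<tau>\<close>: \<open>N\<close> is
  \<open>deriv G \<tau> * h\<close> in the interior case and the constant \<open>1\<close> in the
  boundary case. The equivalences then need only a lower bound and a limit for
  \<open>N\<close>.\<close>

lemma koenigs_equation: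
  assumes G: "\<exists>z\<in>\<D>. G z \<noteq> 0" and k: "koenigs_function G \<tau> h" and \<tau>: "\<tau> \<in> cball 0 1" and x: "cmod x = 1"
    and lim: "nt_limit (\<lambda>z. G z * (z - x)) x A"
  obtains N e where "\<And>z. z \<in> \<D> \<Longrightarrow> deriv h z * G z = N z"
    "e > 0" "eventually (\<lambda>z. e \<le> cmod (N z)) (at x within \<D>)"
    "A \<noteq> 0 \<Longrightarrow> \<exists>n. nt_limit N x n \<and> (\<tau> \<in> \<D> \<longrightarrow>
       (\<exists>hx. nt_limit h x hx \<and> n = hx * deriv G \<tau> \<and> n \<noteq> 0)) \<and> (\<tau> \<in> sphere 0 1 \<longrightarrow> n = 1)"
proof (cases "\<tau> \<in> \<D>")
  case True
  then have h: "h holomorphic_on \<D>" "inj_on h \<D>" "h \<tau> = 0"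
    "\<And>z. z \<in> \<D> \<Longrightarrow> deriv h z * G z = deriv G \<tau> * h z" and not: "\<tau> \<notin> sphere 0 1"
    using k by (auto simp: koenigs_function_def)
  obtain e where e: "e > 0" "eventually (\<lambda>z. e \<le> cmod (h z)) (at x within \<D>)"
    using inj_holomorphic_bounded_away[OF h(1,2) True h(3) x] by blast
  \<comment> \<open>Otherwise \<open>h' * G = 0\<close> on the disc; as \<open>h'\<close> has no
    zeros for univalent \<open>h\<close>, \<open>G\<close> would vanish identically.\<close>
  have c: "deriv G \<tau> \<noteq> 0"
  proof
    assume 0: "deriv G \<tau> = 0"
    obtain z where z: "z \<in> \<D>" "G z \<noteq> 0" using G by blast
    have "deriv h z \<noteq> 0" using holomorphic_injective_imp_regular[OF h(1) open_ball h(2) z(1)] .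
    then show False using h(4)[OF z(1)] z 0 by simp
  qed
  show ?thesis
  proof (rule that[of "\<lambda>z. deriv G \<tau> * h z" "cmod (deriv G \<tau>) * e"])
    show "\<forall>\<^sub>F z in at x within \<D>. cmod (deriv G \<tau>) * e \<le> cmod (deriv G \<tau> * h z)"
      using e(2) by (rule eventually_mono) (use c in \<open>simp add: norm_mult\<close>)
    show "\<exists>n. nt_limit (\<lambda>z. deriv G \<tau> * h z) x n \<and> (\<tau> \<in> \<D> \<longrightarrow>
       (\<exists>hx. nt_limit h x hx \<and> n = hx * deriv G \<tau> \<and> n \<noteq> 0)) \<and> (\<tau> \<in> sphere 0 1 \<longrightarrow> n = 1)"
      if A: "A \<noteq> 0"
    proof -
      obtain l where l: "l \<noteq> 0" "nt_limit h x l"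
        using nt_limit_koenigs_interior[OF x h(1) lim A h(4) e] by blast
      have "nt_limit (\<lambda>z. deriv G \<tau> * h z) x (deriv G \<tau> * l)"
        by (rule nt_limit_mult[OF _ l(2)]) (simp add: nt_limit_def)
      then show ?thesis using l c not by (intro exI[of _ "deriv G \<tau> * l"]) auto
    qed
  qed (use h e c in auto)
next
  case False
  then have "\<tau> \<in> sphere 0 1" using \<tau> by auto
  then show ?thesis using k False
    by (intro that[of "\<lambda>_. 1" 1]) (auto simp: koenigs_function_def nt_limit_def)
qed

section \<open>The equivalences and the boundary values\<close>

theorem theorem4p3:
  fixes G h :: "complex \<Rightarrow> complex" and x \<tau> :: complex
  assumes "infinitesimal_generator G"
    and "\<exists>z\<in>\<D>. G z \<noteq> 0"
    and "denjoy_wolff_point G \<tau>"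
    and "koenigs_function G \<tau> h"
    and "x \<in> sphere 0 1"
  shows "let
      c1 = regular_pole G x;
      c2 = beta_point h x;
      c3 = (Liminf (at_left 1) (\<lambda>r::real. ereal (cmod (deriv h (of_real r * x)) / (1 - r))) < \<infinity>);
      c4 = ((\<exists>l. nt_limit h x l) \<and> nt_limit (deriv h) x 0 \<and>
            (\<exists>l. nt_limit (deriv (deriv h)) x l));
      c5 = (((\<lambda>r::real. cmod (deriv h (of_real r * x))) \<longlongrightarrow> 0) (at_left 1) \<and>
            Limsup (at_left 1) (\<lambda>r::real. ereal (cmod (deriv (deriv h) (of_real r * x)))) < \<infinity>)
    in
      (c1 \<longleftrightarrow> c2) \<and> (c1 \<longleftrightarrow> c3) \<and> (c1 \<longleftrightarrow> c4) \<and> (c1 \<longleftrightarrow> c5) \<and>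
      (c1 \<longrightarrow>
        (\<exists>A. nt_limit (\<lambda>z. G z * (z - x)) x A \<and> regular_pole_of_mass G x (cmod A) \<and>
          (\<tau> \<in> \<D> \<longrightarrow>
            (\<exists>hx. nt_limit h x hx \<and>
                  nt_limit (deriv (deriv h)) x (hx * deriv G \<tau> / A) \<and>
                  nt_limit (\<lambda>z. deriv h z / (z - x)) x (hx * deriv G \<tau> / A) \<and>
                  hx * deriv G \<tau> / A \<noteq> 0)) \<and>
          (\<tau> \<in> sphere 0 1 \<longrightarrow>
            nt_limit (deriv (deriv h)) x (1 / A) \<and>
            nt_limit (\<lambda>z. deriv h z / (z - x)) x (1 / A))))"
proof -
  have x: "cmod x = 1" using assms(5) by simp
  have h: "h holomorphic_on \<D>" using assms(4) by (simp add: koenigs_function_def)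
  then have h': "deriv h holomorphic_on \<D>" by (intro holomorphic_deriv open_ball)
  have \<tau>: "\<tau> \<in> cball 0 1" using assms(3) by (simp add: denjoy_wolff_point_def)
  obtain A where A: "nt_limit (\<lambda>z. G z * (z - x)) x A"
    using nt_limit_generator[OF assms(3) x] by blast
  have c1: "regular_pole G x \<longleftrightarrow> A \<noteq> 0"
    unfolding regular_pole_def regular_pole_of_mass_iff[OF x A] by simp
  obtain N e where N: "\<And>z. z \<in> \<D> \<Longrightarrow> deriv h z * G z = N z"
    and e: "e > 0" "eventually (\<lambda>z. e \<le> cmod (N z)) (at x within \<D>)"
    and n: "A \<noteq> 0 \<Longrightarrow> \<exists>n. nt_limit N x n \<and> (\<tau> \<in> \<D> \<longrightarrow>
       (\<exists>hx. nt_limit h x hx \<and> n = hx * deriv G \<tau> \<and> n \<noteq> 0)) \<and> (\<tau> \<in> sphere 0 1 \<longrightarrow> n = 1)"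
    by (rule koenigs_equation[OF assms(2,4) \<tau> x A]) blast
  define c3 where "c3 \<longleftrightarrow>
    Liminf (at_left 1) (\<lambda>r::real. ereal (cmod (deriv h (of_real r * x)) / (1 - r))) < \<infinity>"
  define c4 where "c4 \<longleftrightarrow> (\<exists>l. nt_limit h x l) \<and> nt_limit (deriv h) x 0 \<and>
            (\<exists>l. nt_limit (deriv (deriv h)) x l)"
  define c5 where "c5 \<longleftrightarrow> ((\<lambda>r::real. cmod (deriv h (of_real r * x))) \<longlongrightarrow> 0) (at_left 1) \<and>
            Limsup (at_left 1) (\<lambda>r::real. ereal (cmod (deriv (deriv h) (of_real r * x)))) < \<infinity>"
  \<comment> \<open>Everything is compared with \<open>A \<noteq> 0\<close>: it implies the
    beta-point condition and \<open>c4\<close>; from there \<open>c4\<close> gives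
    \<open>c5\<close>, both \<open>c5\<close> and the beta-point condition give \<open>c3\<close>,
    and \<open>c3\<close> leads back.\<close>
  have 31: "A \<noteq> 0" if c3
    using regular_pole_if_Liminf_radial[OF x A N e] that unfolding c3_def by blast
  have 23: c3 if "beta_point h x"
    using Liminf_radial_if_beta_point[OF x that] unfolding c3_def .
  have 53: c3 if c5
    using Liminf_radial_if_second_deriv_bounded[OF x h] that unfolding c3_def c5_def by blast
  have 45: c5 if c4
  proof -
    obtain l where l: "nt_limit (deriv (deriv h)) x l" "nt_limit (deriv h) x 0"
      using \<open>c4\<close> unfolding c4_def by blast
    have radial: "((\<lambda>r::real. cmod (f (of_real r * x))) \<longlongrightarrow> cmod m) (at_left 1)"
      if "nt_limit f x m" for f m
      by (rule tendsto_norm, rule filterlim_compose[OF nt_limitD[OF that, of 2]])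
        (use filterlim_radius_stolz_angle x in auto)
    have "Limsup (at_left 1) (\<lambda>r::real. ereal (cmod (deriv (deriv h) (of_real r * x)))) = ereal (cmod l)"
      by (intro lim_imp_Limsup tendsto_ereal radial[OF l(1)]) (simp add: trivial_limit_at_left_real)
    then show ?thesis using radial[OF l(2)] by (simp add: c5_def)
  qed
  \<comment> \<open>The second limit is the derivative transfer applied to \<open>h'\<close> in
    place of \<open>f\<close>, so it has the same value as the first.\<close>
  have 1: "nt_limit (\<lambda>z. deriv h z / (z - x)) x (n / A)" "nt_limit (deriv (deriv h)) x (n / A)"
    if "A \<noteq> 0" "nt_limit N x n" for n
    using nt_limit_deriv_div[OF A that(1) N that(2)] nt_limit_deriv[OF x h'] by blast+
  have 12: "beta_point h x" if "A \<noteq> 0"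
  proof -
    obtain n where "nt_limit N x n" using n \<open>A \<noteq> 0\<close> by blast
    from nt_Limsup_eq[OF x 1(1)[OF that this]] show ?thesis
      by (simp add: beta_point_def norm_divide norm_minus_commute)
  qed
  have 14: c4 if "A \<noteq> 0"
  proof -
    obtain n where n: "nt_limit N x n" using n \<open>A \<noteq> 0\<close> by blast
    have "nt_limit (\<lambda>z. z - x) x (x - x)"
      by (rule nt_limit_continuous) (intro continuous_intros)
    \<comment> \<open>Multiplying the quotient back by \<open>z - x\<close> shows that
      \<open>h'\<close> tends to \<open>0\<close>; being bounded near \<open>x\<close> in each
      angle, it then gives a limit of \<open>h\<close> for both positions of
      \<open>\<tau>\<close>.\<close>
    from nt_limit_mult[OF 1(1)[OF that n] this]
    have "nt_limit (\<lambda>z. deriv h z / (z - x) * (z - x)) x 0" by simp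
    moreover have "deriv h z / (z - x) * (z - x) = deriv h z" if "z \<in> \<D>" for z
      using that x by auto
    ultimately have "nt_limit (deriv h) x 0" by (rule nt_limit_cong[THEN iffD1, rotated])
    then show ?thesis unfolding c4_def
      using nt_limit_if_deriv_nt_limit[OF x h] 1(2)[OF that n] by blast
  qed
  have fin: "\<exists>A. nt_limit (\<lambda>z. G z * (z - x)) x A \<and> regular_pole_of_mass G x (cmod A) \<and>
          (\<tau> \<in> \<D> \<longrightarrow>
            (\<exists>hx. nt_limit h x hx \<and>
                  nt_limit (deriv (deriv h)) x (hx * deriv G \<tau> / A) \<and>
                  nt_limit (\<lambda>z. deriv h z / (z - x)) x (hx * deriv G \<tau> / A) \<and>
                  hx * deriv G \<tau> / A \<noteq> 0)) \<and>
          (\<tau> \<in> sphere 0 1 \<longrightarrow>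
            nt_limit (deriv (deriv h)) x (1 / A) \<and>
            nt_limit (\<lambda>z. deriv h z / (z - x)) x (1 / A))" if A0: "A \<noteq> 0"
  proof (rule exI[of _ A], intro conjI impI)
    from n[OF A0] obtain n where n: "nt_limit N x n"
      "\<tau> \<in> \<D> \<longrightarrow> (\<exists>hx. nt_limit h x hx \<and> n = hx * deriv G \<tau> \<and> n \<noteq> 0)"
      "\<tau> \<in> sphere 0 1 \<longrightarrow> n = 1"
      by (elim exE conjE)
    note lims = 1[OF A0 n(1)]
    show "regular_pole_of_mass G x (cmod A)" using regular_pole_of_mass_iff[OF x A] A0 by simp
    show "\<exists>hx. nt_limit h x hx \<and>
                  nt_limit (deriv (deriv h)) x (hx * deriv G \<tau> / A) \<and>
                  nt_limit (\<lambda>z. deriv h z / (z - x)) x (hx * deriv G \<tau> / A) \<and>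
                  hx * deriv G \<tau> / A \<noteq> 0" if "\<tau> \<in> \<D>"
    proof -
      obtain hx where "nt_limit h x hx" "n = hx * deriv G \<tau>" "n \<noteq> 0" using n(2) \<open>\<tau> \<in> \<D>\<close> by blast
      then show ?thesis using lims A0 by (intro exI[of _ hx]) auto
    qed
    show "nt_limit (deriv (deriv h)) x (1 / A)" "nt_limit (\<lambda>z. deriv h z / (z - x)) x (1 / A)"
      if "\<tau> \<in> sphere 0 1" using lims n(3) that by auto
  qed (rule A)
  show ?thesis
    unfolding Let_def c1 c3_def[symmetric] c4_def[symmetric] c5_def[symmetric]
  proof (intro conjI impI iffI)
    show "beta_point h x" if "A \<noteq> 0" by (rule 12[OF that])
    show c4 if "A \<noteq> 0" by (rule 14[OF that])
    show c5 if "A \<noteq> 0" by (rule 45[OF 14[OF that]])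
    show c3 if "A \<noteq> 0" by (rule 23[OF 12[OF that]])
    show "A \<noteq> 0" if c3 by (rule 31[OF that])
    show "A \<noteq> 0" if c5 by (rule 31[OF 53[OF that]])
    show "A \<noteq> 0" if c4 by (rule 31[OF 53[OF 45[OF that]]])
    show "A \<noteq> 0" if "beta_point h x" by (rule 31[OF 23[OF that]])
  qed (rule fin)
qed

end
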